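(* Consider the dynamics $\dot x=f(t,x)+g(t,x)$ with $f,g:\mathbb{R}_{\ge0}\times\mathbb{R}^n\to\mathbb{R}^n$ continuous. Suppose that, with respect to the same weak pairing $[\![\cdot,\cdot]\!]$ compatible with a norm $\|\cdot\|$ on $\mathbb{R}^n$, $\operatorname{osL}(f(t,\cdot))\le -c<0$ and $\operatorname{osL}(g(t,\cdot))\le d\in\mathbb{R}$ for all $t\ge0$. Then: (i) if $d<c$, then $f+g$ is strongly contracting with rate $c-d$; (ii) if additionally ($d<c$ and) $f$ and $g$ are time-invariant, then the unique equilibrium point $x^*$ of $f$ and the unique equilibrium point $x^{**}$ of $f+g$ satisfy $$\|x^*-x^{**}\|\le\frac{\|g(x^* )\|}{c-d}.$$
   Context: A weak pairing on $\mathbb{R}^n$ is a map $[\![\cdot,\cdot]\!]:\mathbb{R}^n\times\mathbb{R}^n\to\mathbb{R}$ such that: (1) $[\![x_1+x_2,y]\!]\le[\![x_1,y]\!]+[\![x_2,y]\!]$ for all $x_1,x_2,y$, and it is continuous in its first argument; (2) $[\![\alpha x,y]\!]=[\![x,\alpha y]\!]=\alpha[\![x,y]\!]$ for all $x,y$ and all $\alpha\ge 0$, and $[\![-x,-y]\!]=[\![x,y]\!]$; (3) $[\![x,x]\!]>0$ for all $x\ne 0_n$; (4) $|[\![x,y]\!]|\le[\![x,x]\!]^{1/2}[\![y,y]\!]^{1/2}$ for all $x,y$. It is compatible with the norm $\|\cdot\|$ if $[\![x,x]\!]=\|x\|^2$ for all $x$. For a map $h:\mathbb{R}^n\to\mathbb{R}^n$,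 $\operatorname{osL}(h)=\sup_{x\ne y}\frac{[\![h(x)-h(y),x-y]\!]}{\|x-y\|^2}\in\mathbb{R}\cup\{\infty\}$; by convention, when one-sided Lipschitz bounds are considered the weak pairing is assumed to satisfy Deimling's inequality $[\![x,y]\!]\le\|y\|\lim_{s\to0^+}\frac{\|y+sx\|-\|y\|}{s}$ for all $x,y$. A vector field $F(t,x)$ is strongly contracting with rate $r>0$ (with respect to $\|\cdot\|$) if $\operatorname{osL}(F(t,\cdot))\le -r$ for all $t\ge0$. An equilibrium point of a time-invariant vector field $F$ is a point where $F$ vanishes. *)

theory Defs
  imports "HOL-Analysis.Analysis"
begin

text \<open>Topological notions on \<^typ>\<open>real ^ 'n\<close> use the standard topology, which is the
  one induced by every norm.  The norm \<open>N\<close> of the statement is arbitrary and unrelated to the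
  Euclidean \<^const>\<open>norm\<close>.\<close>

definition is_norm :: "(real ^ 'n \<Rightarrow> real) \<Rightarrow> bool" where
  "is_norm N \<longleftrightarrow>
     (\<forall>x. N x = 0 \<longleftrightarrow> x = 0) \<and>
     (\<forall>a x. N (a *\<^sub>R x) = \<bar>a\<bar> * N x) \<and>
     (\<forall>x y. N (x + y) \<le> N x + N y)"

definition weak_pairing :: "(real ^ 'n \<Rightarrow> real ^ 'n \<Rightarrow> real) \<Rightarrow> bool" where
  "weak_pairing wp \<longleftrightarrow>
     (\<forall>x1 x2 y. wp (x1 + x2) y \<le> wp x1 y + wp x2 y) \<and>
     (\<forall>y. continuous_on UNIV (\<lambda>x. wp x y)) \<and>
     (\<forall>x y. \<forall>\<alpha>\<ge>0. wp (\<alpha> *\<^sub>R x) y = \<alpha> * wp x y \<and> wp x (\<alpha> *\<^sub>R y) = \<alpha> * wp x y) \<and>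
     (\<forall>x y. wp (- x) (- y) = wp x y) \<and>
     (\<forall>x. x \<noteq> 0 \<longrightarrow> wp x x > 0) \<and>
     (\<forall>x y. \<bar>wp x y\<bar> \<le> sqrt (wp x x) * sqrt (wp y y))"

definition compatible ::
  "(real ^ 'n \<Rightarrow> real ^ 'n \<Rightarrow> real) \<Rightarrow> (real ^ 'n \<Rightarrow> real) \<Rightarrow> bool" where
  "compatible wp N \<longleftrightarrow> (\<forall>x. wp x x = (N x)\<^sup>2)"

text \<open>The one-sided limit below exists whenever \<open>N\<close> is a norm, since the difference quotient is
  then nondecreasing in \<open>s > 0\<close> and bounded below by \<open>- N x\<close>; hence \<^const>\<open>Lim\<close> denotes it.\<close>

definition deimling ::
  "(real ^ 'n \<Rightarrow> real ^ 'n \<Rightarrow> real) \<Rightarrow> (real ^ 'n \<Rightarrow> real) \<Rightarrow> bool" where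
  "deimling wp N \<longleftrightarrow>
     (\<forall>x y. wp x y \<le> N y * Lim (at_right 0) (\<lambda>s. (N (y + s *\<^sub>R x) - N y) / s))"

definition osL ::
  "(real ^ 'n \<Rightarrow> real ^ 'n \<Rightarrow> real) \<Rightarrow> (real ^ 'n \<Rightarrow> real) \<Rightarrow> (real ^ 'n \<Rightarrow> real ^ 'n) \<Rightarrow> ereal"
  where
  "osL wp N h =
     (SUP (x, y) \<in> {(x, y). x \<noteq> y}. ereal (wp (h x - h y) (x - y) / (N (x - y))\<^sup>2))"

text \<open>A vector field takes the time as its first argument; only its values at times \<open>t \<ge> 0\<close>
  are relevant.\<close>

definition strongly_contracting ::
  "(real ^ 'n \<Rightarrow> real ^ 'n \<Rightarrow> real) \<Rightarrow> (real ^ 'n \<Rightarrow> real) \<Rightarrow>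
   (real \<Rightarrow> real ^ 'n \<Rightarrow> real ^ 'n) \<Rightarrow> real \<Rightarrow> bool" where
  "strongly_contracting wp N F r \<longleftrightarrow> r > 0 \<and> (\<forall>t\<ge>0. osL wp N (F t) \<le> ereal (- r))"

definition equilibrium :: "(real ^ 'n \<Rightarrow> real ^ 'n) \<Rightarrow> real ^ 'n \<Rightarrow> bool" where
  "equilibrium F x \<longleftrightarrow> F x = 0"

end

theory Submission
  imports Defs
begin

text \<open>A bound \<open>osL h \<le> b\<close> says that \<open>wp (h x - h y) (x - y) \<le> b * (N (x - y))\<^sup>2\<close> for all \<open>x\<close> and
  \<open>y\<close>.  Such bounds add up because a weak pairing is subadditive in its first argument
  (\<open>osL_add_le\<close>), which is part (i).  For part (ii) let \<open>h\<close> satisfy the bound with \<open>b = - r < 0\<close>.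
  Combined with the Cauchy--Schwarz inequality, the bound becomes the expansion estimate
  \<open>r * N (x - y) \<le> N (h x - h y)\<close> (\<open>osL_neg_expansive\<close>).  It makes \<open>h\<close> injective, and applied to
  \<open>h = F + G\<close> at the two equilibria, where \<open>h\<close> takes the values \<open>G x*\<close> and \<open>0\<close>, it is the claimed
  distance estimate.

  Existence of an equilibrium is obtained from Brouwer's fixed point theorem instead of the
  contraction of the flow (\<open>osL_neg_zero_exists\<close>).  If \<open>h\<close> had no zero in the \<open>N\<close>-ball of
  radius \<open>R\<close>, then \<open>x \<mapsto> R h(x) / N (h x)\<close> would map that ball to itself and so would have a
  fixed point \<open>x\<close>.  At this point \<open>N x = R\<close> and \<open>h\<close> points exactly outwards, while the
  one-sided Lipschitz bound between \<open>x\<close> and \<open>0\<close> forces \<open>h\<close> to point inwards once \<open>R\<close> is large.\<close>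

lemma is_norm_zero: "is_norm N \<Longrightarrow> N 0 = 0"
  and is_norm_eq_zero: "is_norm N \<Longrightarrow> N x = 0 \<longleftrightarrow> x = 0"
  and is_norm_scaleR: "is_norm N \<Longrightarrow> N (a *\<^sub>R x) = \<bar>a\<bar> * N x"
  and is_norm_triangle: "is_norm N \<Longrightarrow> N (x + y) \<le> N x + N y"
  unfolding is_norm_def by blast+

lemma is_norm_nonneg:
  assumes "is_norm N"
  shows "0 \<le> N x"
proof -
  have "N (x + (-1) *\<^sub>R x) \<le> N x + \<bar>-1\<bar> * N x"
    using is_norm_triangle[OF assms, of x "(-1) *\<^sub>R x"] is_norm_scaleR[OF assms, of "-1" x]
    by simp
  then show ?thesis
    using is_norm_zero[OF assms] by simp
qed

lemma is_norm_convex_on: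
  assumes "is_norm N"
  shows "convex_on UNIV N"
proof (rule convex_onI)
  fix t :: real and x y
  assume "0 < t" "t < 1"
  then show "N ((1 - t) *\<^sub>R x + t *\<^sub>R y) \<le> (1 - t) * N x + t * N y"
    using is_norm_triangle[OF assms, of "(1 - t) *\<^sub>R x" "t *\<^sub>R y"]
    by (simp add: is_norm_scaleR[OF assms])
qed simp

lemma is_norm_continuous:
  assumes "is_norm N"
  shows "continuous_on A N"
  using convex_on_continuous[OF open_UNIV is_norm_convex_on[OF assms]]
  by (rule continuous_on_subset) simp

lemma is_norm_lower_bound:
  fixes N :: "real ^ 'n \<Rightarrow> real"
  assumes "is_norm N"
  obtains m where "m > 0" "\<And>x. m * norm x \<le> N x"
proof -
  have ne: "sphere (0 :: real ^ 'n) 1 \<noteq> {}"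
    by (simp add: sphere_eq_empty)
  obtain u where u: "u \<in> sphere 0 1" "\<And>x. x \<in> sphere 0 1 \<Longrightarrow> N u \<le> N x"
    using continuous_attains_inf[OF compact_sphere ne is_norm_continuous[OF assms]] by blast
  have "N u \<noteq> 0"
    using u(1) is_norm_eq_zero[OF assms, of u] by auto
  then have "N u > 0"
    using is_norm_nonneg[OF assms, of u] by simp
  moreover have "N u * norm x \<le> N x" for x
  proof (cases "x = 0")
    case False
    then have "N u \<le> N ((1 / norm x) *\<^sub>R x)"
      by (intro u(2)) simp
    with False show ?thesis
      by (simp add: is_norm_scaleR[OF assms] field_simps)
  qed (simp add: is_norm_zero[OF assms])
  ultimately show ?thesis
    by (rule that)
qed

lemma is_norm_ball_compact:
  fixes N :: "real ^ 'n \<Rightarrow> real"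
  assumes "is_norm N"
  shows "compact {x. N x \<le> R}"
proof -
  obtain m where m: "m > 0" "\<And>x. m * norm x \<le> N x"
    using is_norm_lower_bound[OF assms] by blast
  have "norm x \<le> R / m" if "N x \<le> R" for x
    using m(2)[of x] that m(1) by (simp add: field_simps)
  then have "bounded {x. N x \<le> R}"
    by (auto simp: bounded_iff)
  moreover have "closed {x. N x \<le> R}"
    by (intro closed_Collect_le is_norm_continuous[OF assms] continuous_on_const)
  ultimately show ?thesis
    by (simp add: compact_eq_bounded_closed)
qed

lemma is_norm_ball_convex:
  assumes "is_norm N"
  shows "convex {x. N x \<le> R}"
proof (rule convexI)
  fix x y and u v :: real
  assume "x \<in> {x. N x \<le> R}" "y \<in> {x. N x \<le> R}" and uv: "0 \<le> u" "0 \<le> v" "u + v = 1"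
  then have "u * N x + v * N y \<le> R"
    by (intro convex_bound_le) auto
  then show "u *\<^sub>R x + v *\<^sub>R y \<in> {x. N x \<le> R}"
    using is_norm_triangle[OF assms, of "u *\<^sub>R x" "v *\<^sub>R y"] uv
    by (simp add: is_norm_scaleR[OF assms])
qed

lemma weak_pairing_add_left: "weak_pairing wp \<Longrightarrow> wp (x1 + x2) y \<le> wp x1 y + wp x2 y"
  and weak_pairing_scaleR_left: "weak_pairing wp \<Longrightarrow> 0 \<le> a \<Longrightarrow> wp (a *\<^sub>R x) y = a * wp x y"
  unfolding weak_pairing_def by blast+

lemma weak_pairing_zero_left:
  assumes "weak_pairing wp"
  shows "wp 0 y = 0"
  using weak_pairing_scaleR_left[OF assms, of 0 0 y] by simp

lemma weak_pairing_Cauchy_Schwarz: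
  assumes "is_norm N" "weak_pairing wp" "compatible wp N"
  shows "\<bar>wp x y\<bar> \<le> N x * N y"
proof -
  have "\<bar>wp x y\<bar> \<le> sqrt (wp x x) * sqrt (wp y y)"
    using assms(2) unfolding weak_pairing_def by blast
  then show ?thesis
    using assms(3) is_norm_nonneg[OF assms(1)] unfolding compatible_def by simp
qed

lemma osL_le_iff:
  assumes "is_norm N" "weak_pairing wp"
  shows "osL wp N h \<le> ereal b \<longleftrightarrow> (\<forall>x y. wp (h x - h y) (x - y) \<le> b * (N (x - y))\<^sup>2)"
proof -
  have quot: "wp (h x - h y) (x - y) / (N (x - y))\<^sup>2 \<le> b \<longleftrightarrow>
      wp (h x - h y) (x - y) \<le> b * (N (x - y))\<^sup>2" if "x \<noteq> y" for x y
  proof -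
    have "(N (x - y))\<^sup>2 > 0"
      using that is_norm_eq_zero[OF assms(1), of "x - y"] by simp
    then show ?thesis
      by (rule pos_divide_le_eq)
  qed
  have diag: "wp (h x - h x) (x - x) \<le> b * (N (x - x))\<^sup>2" for x
    by (simp add: weak_pairing_zero_left[OF assms(2)] is_norm_zero[OF assms(1)])
  have "osL wp N h \<le> ereal b \<longleftrightarrow>
      (\<forall>x y. x \<noteq> y \<longrightarrow> wp (h x - h y) (x - y) / (N (x - y))\<^sup>2 \<le> b)"
    unfolding osL_def by (auto simp: SUP_le_iff)
  also have "\<dots> \<longleftrightarrow> (\<forall>x y. wp (h x - h y) (x - y) \<le> b * (N (x - y))\<^sup>2)"
    using quot diag by metis
  finally show ?thesis .
qed

lemma osL_add_le:
  assumes "is_norm N" "weak_pairing wp"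
    and "osL wp N h \<le> ereal a" "osL wp N k \<le> ereal b"
  shows "osL wp N (\<lambda>x. h x + k x) \<le> ereal (a + b)"
  unfolding osL_le_iff[OF assms(1,2)]
proof (intro allI)
  fix x y
  have "wp (h x + k x - (h y + k y)) (x - y) = wp ((h x - h y) + (k x - k y)) (x - y)"
    by (simp add: algebra_simps)
  also have "\<dots> \<le> wp (h x - h y) (x - y) + wp (k x - k y) (x - y)"
    by (rule weak_pairing_add_left[OF assms(2)])
  also have "\<dots> \<le> a * (N (x - y))\<^sup>2 + b * (N (x - y))\<^sup>2"
    using assms(3,4) unfolding osL_le_iff[OF assms(1,2)] by (intro add_mono) auto
  finally show "wp (h x + k x - (h y + k y)) (x - y) \<le> (a + b) * (N (x - y))\<^sup>2"
    by (simp add: algebra_simps)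
qed

text \<open>The Cauchy--Schwarz inequality bounds the pairing below by \<open>- N (h x - h y) * N (x - y)\<close>, and
  one factor \<open>N (x - y)\<close> cancels against the square.\<close>

lemma osL_neg_expansive:
  assumes "is_norm N" "weak_pairing wp" "compatible wp N"
    and "osL wp N h \<le> ereal (- r)"
  shows "r * N (x - y) \<le> N (h x - h y)"
proof (cases "x = y")
  case False
  then have pos: "N (x - y) > 0"
    using is_norm_nonneg[OF assms(1), of "x - y"] is_norm_eq_zero[OF assms(1), of "x - y"] by simp
  have "wp (h x - h y) (x - y) \<le> - r * (N (x - y))\<^sup>2"
    using assms(4) unfolding osL_le_iff[OF assms(1,2)] by blast
  then have "r * N (x - y) * N (x - y) \<le> N (h x - h y) * N (x - y)"
    using weak_pairing_Cauchy_Schwarz[OF assms(1-3), of "h x - h y" "x - y"]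
    by (simp add: power2_eq_square)
  with pos show ?thesis
    by simp
qed (simp add: is_norm_zero[OF assms(1)])

text \<open>At a fixed point \<open>x\<close> of the normalised field, \<open>h x = s x\<close> with \<open>s > 0\<close> and \<open>N x = R\<close>, so
  \<open>s R\<^sup>2 = wp (h x) x \<le> wp (h x - h 0) x + wp (h 0) x \<le> - r R\<^sup>2 + N (h 0) R\<close>, which is negative as
  soon as \<open>r R > N (h 0)\<close>.\<close>

lemma osL_neg_zero_exists:
  fixes h :: "real ^ 'n \<Rightarrow> real ^ 'n"
  assumes norm: "is_norm N" and wp: "weak_pairing wp" and comp: "compatible wp N"
    and r: "r > 0" and cont: "continuous_on UNIV h" and osL: "osL wp N h \<le> ereal (- r)"
  shows "\<exists>x. h x = 0"
proof (rule ccontr)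
  assume "\<nexists>x. h x = 0"
  then have Nh: "N (h x) > 0" for x
    using is_norm_nonneg[OF norm, of "h x"] is_norm_eq_zero[OF norm, of "h x"] by auto
  define R where "R = N (h 0) / r + 1"
  have R: "R > 0" "r * R > N (h 0)"
    using r is_norm_nonneg[OF norm, of "h 0"] by (auto simp: R_def field_simps add_pos_nonneg)
  let ?B = "{x. N x \<le> R}" and ?T = "\<lambda>x. (R / N (h x)) *\<^sub>R h x"
  have NT: "N (?T x) = R" for x
    using Nh[of x] R(1) by (simp add: is_norm_scaleR[OF norm])
  have "continuous_on ?B h"
    using cont by (rule continuous_on_subset) simp
  moreover have "continuous_on ?B (\<lambda>x. N (h x))"
    using continuous_on_compose2[OF is_norm_continuous[OF norm, of UNIV] calculation] by simp
  moreover have "\<forall>x\<in>?B. N (h x) \<noteq> 0"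
    using Nh less_irrefl by metis
  ultimately have "continuous_on ?B ?T"
    by (intro continuous_intros) auto
  moreover have "0 \<in> ?B"
    using R(1) by (simp add: is_norm_zero[OF norm])
  moreover have "?T \<in> ?B \<rightarrow> ?B"
    by (simp add: NT)
  ultimately obtain x where x: "?T x = x"
    using brouwer[OF is_norm_ball_compact[OF norm] is_norm_ball_convex[OF norm]] by blast
  then have Nx: "N x = R"
    using NT[of x] by simp
  define s where "s = N (h x) / R"
  have s: "s > 0" "h x = s *\<^sub>R x"
  proof -
    show "s > 0"
      using Nh R(1) by (simp add: s_def)
    have "s *\<^sub>R x = s *\<^sub>R ?T x"
      by (simp only: x)
    then show "h x = s *\<^sub>R x"
      using Nh[of x] R(1) by (simp add: s_def)
  qed
  have "s * R\<^sup>2 = wp (h x) x"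
    using comp s by (simp add: compatible_def weak_pairing_scaleR_left[OF wp] Nx)
  also have "\<dots> \<le> wp (h x - h 0) (x - 0) + wp (h 0) x"
    using weak_pairing_add_left[OF wp, of "h x - h 0" "h 0" x] by simp
  also have "\<dots> \<le> - r * (N (x - 0))\<^sup>2 + N (h 0) * N x"
  proof (rule add_mono)
    show "wp (h x - h 0) (x - 0) \<le> - r * (N (x - 0))\<^sup>2"
      using osL unfolding osL_le_iff[OF norm wp] by blast
    show "wp (h 0) x \<le> N (h 0) * N x"
      using weak_pairing_Cauchy_Schwarz[OF norm wp comp, of "h 0" x] by simp
  qed
  also have "\<dots> = (N (h 0) - r * R) * R"
    by (simp add: Nx power2_eq_square algebra_simps)
  also have "\<dots> < 0"
    using R by (simp add: mult_neg_pos)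
  finally show False
    using s(1) R(1) by (simp add: mult_less_0_iff)
qed

lemma osL_neg_equilibrium_unique:
  fixes h :: "real ^ 'n \<Rightarrow> real ^ 'n"
  assumes "is_norm N" "weak_pairing wp" "compatible wp N"
    and "r > 0" "continuous_on UNIV h" "osL wp N h \<le> ereal (- r)"
  shows "\<exists>!x. equilibrium h x"
proof -
  have "x = y" if "h x = 0" "h y = 0" for x y
  proof -
    have "r * N (x - y) \<le> 0"
      using osL_neg_expansive[OF assms(1-3,6), of x y] that by (simp add: is_norm_zero[OF assms(1)])
    then have "N (x - y) = 0"
      using assms(4) is_norm_nonneg[OF assms(1), of "x - y"] by (simp add: mult_le_0_iff)
    then show ?thesis
      using is_norm_eq_zero[OF assms(1), of "x - y"] by simp
  qed
  then show ?thesis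
    using osL_neg_zero_exists[OF assms] unfolding equilibrium_def by blast
qed

lemma continuous_on_time_slice:
  assumes "continuous_on (A \<times> UNIV) (\<lambda>(t, x). f t x)" "t \<in> A"
  shows "continuous_on UNIV (f t)"
proof -
  have "continuous_on UNIV (\<lambda>x. case (t, x) of (t, x) \<Rightarrow> f t x)"
    by (rule continuous_on_compose2[OF assms(1)]) (use assms(2) in \<open>auto intro!: continuous_intros\<close>)
  then show ?thesis
    by simp
qed

theorem theorem38:
  fixes wp :: "real ^ 'n \<Rightarrow> real ^ 'n \<Rightarrow> real"
    and N :: "real ^ 'n \<Rightarrow> real"
    and f g :: "real \<Rightarrow> real ^ 'n \<Rightarrow> real ^ 'n"
    and c d :: real
  assumes "is_norm N"
    and "weak_pairing wp"
    and "compatible wp N"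
    and "deimling wp N"
    and "continuous_on ({0..} \<times> UNIV) (\<lambda>(t, x). f t x)"
    and "continuous_on ({0..} \<times> UNIV) (\<lambda>(t, x). g t x)"
    and "- c < 0"
    and "\<forall>t\<ge>0. osL wp N (f t) \<le> ereal (- c)"
    and "\<forall>t\<ge>0. osL wp N (g t) \<le> ereal d"
  shows "(d < c \<longrightarrow> strongly_contracting wp N (\<lambda>t x. f t x + g t x) (c - d)) \<and>
    (\<forall>F G. d < c \<and> (\<forall>t\<ge>0. f t = F) \<and> (\<forall>t\<ge>0. g t = G) \<longrightarrow>
       (\<exists>!x. equilibrium F x) \<and>
       (\<exists>!x. equilibrium (\<lambda>x. F x + G x) x) \<and>
       (\<forall>xs xss. equilibrium F xs \<and> equilibrium (\<lambda>x. F x + G x) xss \<longrightarrow>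
          N (xs - xss) \<le> N (G xs) / (c - d)))"
proof (intro conjI impI allI)
  have osL_sum: "osL wp N (\<lambda>x. f t x + g t x) \<le> ereal (- (c - d))" if "t \<ge> 0" for t
    using osL_add_le[OF assms(1,2), of "f t" "- c" "g t" d] assms(8,9) that by simp
  show "strongly_contracting wp N (\<lambda>t x. f t x + g t x) (c - d)" if "d < c"
    using that osL_sum by (simp add: strongly_contracting_def)
  fix F G
  assume FG: "d < c \<and> (\<forall>t\<ge>0. f t = F) \<and> (\<forall>t\<ge>0. g t = G)"
  then have r: "c - d > 0" and FG0: "f 0 = F" "g 0 = G"
    by auto
  have contF: "continuous_on UNIV F" and contG: "continuous_on UNIV G"
    using continuous_on_time_slice[OF assms(5), of 0] continuous_on_time_slice[OF assms(6), of 0]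
    by (simp_all add: FG0)
  have osLF: "osL wp N F \<le> ereal (- c)"
    using assms(8) FG0(1) by auto
  have osLH: "osL wp N (\<lambda>x. F x + G x) \<le> ereal (- (c - d))"
    using osL_sum[of 0] FG0 by simp
  show "\<exists>!x. equilibrium F x"
    using osL_neg_equilibrium_unique[OF assms(1-3) _ contF osLF] assms(7) by simp
  show "\<exists>!x. equilibrium (\<lambda>x. F x + G x) x"
    by (rule osL_neg_equilibrium_unique[OF assms(1-3) r continuous_on_add[OF contF contG] osLH])
  show "N (xs - xss) \<le> N (G xs) / (c - d)"
    if "equilibrium F xs \<and> equilibrium (\<lambda>x. F x + G x) xss" for xs xss
  proof -
    have "(c - d) * N (xs - xss) \<le> N (G xs)"
      using osL_neg_expansive[OF assms(1-3) osLH, of xs xss] that by (simp add: equilibrium_def)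
    then show ?thesis
      using r by (simp add: pos_le_divide_eq mult.commute)
  qed
qed

end
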